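(* For all integers $a,d,u$ satisfying $$a\ge0,\qquad 0\le d\le (a+1)/2,\qquad 0\le u\le a+1-2d,\qquad d\text{ and }u\text{ not both zero},$$ one has $$T(a,d,u)=0\qquad\text{and}\qquad T_1(a,d,u)=0 .$$
   Context: $\mathbf v=\sqrt q$ with $q$ a prime power. $[n]=\frac{\mathbf v^n-\mathbf v^{-n}}{\mathbf v-\mathbf v^{-1}}$, $[n]!=\prod_{s=1}^n[s]$, $[0]^{!!}=1$, $[2l]^{!!}=[2l][2l-2]\cdots[2]$; $\begin{bmatrix} u \\ b \end{bmatrix}$ is the $\mathbf v$-binomial coefficient $\frac{[u][u-1]\cdots[u-b+1]}{[b]!}$, equal to $0$ if $b<0$ or $b>u$. For given $a,d,u$ and indices $n,k,m$, put $r=d-k-m$ and $$p(a,r,s,t)=-s(a+t)+2ra+(u-t+2s-r)(t-r)+(s-r)^2+\binom{s-r}{2}+(t-r)^2+\binom{t-r}{2}+r(s+t)-\binom{r+1}{2}+1,$$ $$z=k(k-1)+m(m+1)-\binom{n-2k}{2}-\binom{1+a-n-2m}{2}+p(a,r,n-2k,1+a-n-2m),$$ where $\binom{x}{2}=x(x-1)/2$. Let $\delta\{X\}=1$ if the statement $X$ holds and $0$ otherwise (terms with $\delta=0$ are omitted). Define $$T(a,d,u)=\sum_{\substack{0\le n\le a+1\\ n\text{ even}}}\sum_{k=0}^{n/2}\ \sum_{m=0}^{\lfloor\frac{a+1-n}2\rfloor}\delta\{0\le r\le n-2k\}\frac{\mathbf v^{z}}{[r]![2k]^{!!}[2m]^{!!}}\begin{bmatrix}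 u \\ 1+a-n-2m-r \end{bmatrix}-\sum_{\substack{0\le n\le a+1\\ n\text{ odd}}}\sum_{k=0}^{(n-1)/2}\ \sum_{m=0}^{\lfloor\frac{a+1-n}2\rfloor}\delta\{0\le r\le n-2k\}\frac{\mathbf v^{z+2k-2m}}{[r]![2k]^{!!}[2m]^{!!}}\begin{bmatrix} u \\ 1+a-n-2m-r \end{bmatrix},$$ and let $T_1(a,d,u)$ be given by the same formula with the exponent $z$ in the first (even $n$) sum replaced by $z+2k-2m$ and the exponent $z+2k-2m$ in the second (odd $n$) sum replaced by $z$. *)

theory Defs
  imports Complex_Main "HOL-Number_Theory.Prime_Powers"
begin

definition qint :: "real \<Rightarrow> int \<Rightarrow> real" where
  "qint v n = (v powi n - v powi (- n)) / (v - inverse v)"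

definition qfact :: "real \<Rightarrow> int \<Rightarrow> real" where
  "qfact v n = (\<Prod>s\<in>{1..n}. qint v s)"

(* The argument is half of the index: qdfact v l is [2l]!! = [2l][2l-2]...[2]. *)
definition qdfact :: "real \<Rightarrow> int \<Rightarrow> real" where
  "qdfact v l = (\<Prod>s\<in>{1..l}. qint v (2 * s))"

definition qbinom :: "real \<Rightarrow> int \<Rightarrow> int \<Rightarrow> real" where
  "qbinom v u b =
     (if b < 0 \<or> b > u then 0 else (\<Prod>i\<in>{0..<b}. qint v (u - i)) / qfact v b)"

(* x(x-1)/2 for an arbitrary, possibly negative, integer x; the division is exact. *)
definition choose2 :: "int \<Rightarrow> int" where
  "choose2 x = x * (x - 1) div 2"

definition pexp :: "int \<Rightarrow> int \<Rightarrow> int \<Rightarrow> int \<Rightarrow> int \<Rightarrow> int" where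
  "pexp u a r s t =
     - s * (a + t) + 2 * r * a + (u - t + 2 * s - r) * (t - r)
     + (s - r)^2 + choose2 (s - r) + (t - r)^2 + choose2 (t - r)
     + r * (s + t) - choose2 (r + 1) + 1"

definition zexp :: "int \<Rightarrow> int \<Rightarrow> int \<Rightarrow> int \<Rightarrow> int \<Rightarrow> int \<Rightarrow> int" where
  "zexp a d u n k m =
     k * (k - 1) + m * (m + 1) - choose2 (n - 2 * k) - choose2 (1 + a - n - 2 * m)
     + pexp u a (d - k - m) (n - 2 * k) (1 + a - n - 2 * m)"

(* One term of the sums, with e the exponent of v. *)
definition summand ::
  "real \<Rightarrow> int \<Rightarrow> int \<Rightarrow> int \<Rightarrow> int \<Rightarrow> int \<Rightarrow> int \<Rightarrow> int \<Rightarrow> real" where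
  "summand v a d u n k m e =
     (let r = d - k - m in
      if 0 \<le> r \<and> r \<le> n - 2 * k
      then v powi e / (qfact v r * qdfact v k * qdfact v m)
             * qbinom v u (1 + a - n - 2 * m - r)
      else 0)"

definition T :: "real \<Rightarrow> int \<Rightarrow> int \<Rightarrow> int \<Rightarrow> real" where
  "T v a d u =
     (\<Sum>n\<in>{n\<in>{0..a + 1}. even n}. \<Sum>k\<in>{0..n div 2}. \<Sum>m\<in>{0..(a + 1 - n) div 2}.
        summand v a d u n k m (zexp a d u n k m))
   - (\<Sum>n\<in>{n\<in>{0..a + 1}. odd n}. \<Sum>k\<in>{0..(n - 1) div 2}. \<Sum>m\<in>{0..(a + 1 - n) div 2}.
        summand v a d u n k m (zexp a d u n k m + 2 * k - 2 * m))"

definition T1 :: "real \<Rightarrow> int \<Rightarrow> int \<Rightarrow> int \<Rightarrow> real" where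
  "T1 v a d u =
     (\<Sum>n\<in>{n\<in>{0..a + 1}. even n}. \<Sum>k\<in>{0..n div 2}. \<Sum>m\<in>{0..(a + 1 - n) div 2}.
        summand v a d u n k m (zexp a d u n k m + 2 * k - 2 * m))
   - (\<Sum>n\<in>{n\<in>{0..a + 1}. odd n}. \<Sum>k\<in>{0..(n - 1) div 2}. \<Sum>m\<in>{0..(a + 1 - n) div 2}.
        summand v a d u n k m (zexp a d u n k m))"

end

theory Submission
  imports Defs
begin

text \<open>Put \<open>b = 1 + a - n - 2m - r\<close>, the lower entry of the binomial coefficient. In the independent
  indices \<open>k\<close>, \<open>m\<close>, \<open>b\<close> the quadratic terms of the exponent mixing \<open>b\<close> with \<open>r\<close> cancel, and after the
  symmetry \<open>k \<leftrightarrow> m\<close> both \<open>T\<close> and \<open>T\<^sub>1\<close> become, up to a monomial, a product of a sum over \<open>b\<close> and a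
  sum over \<open>(k, m)\<close>. By the \<open>q\<close>-binomial theorem the former is
  \<open>\<Prod>i<u. 1 - v^(2i+2d)\<close>, which vanishes if \<open>d = 0 < u\<close>. In the latter, the sum over \<open>k + m = c\<close> is
  evaluated by an identity of Gauss as \<open>v^(c(c+1)/2) / [c]!\<close>, and the remaining sum over \<open>r + c = d\<close> is
  a multiple of \<open>\<Prod>i<d. 1 - v^(2i)\<close>, which vanishes if \<open>d > 0\<close>.\<close>

section \<open>Quantum integers and factorials\<close>

lemma qint_0 [simp]: "qint v 0 = 0"
  by (simp add: qint_def)

text \<open>The asymmetric form of addition: its two summands carry single powers of
  \<open>v\<close>, so multiplying a convolution by \<open>[m + n]\<close> splits it into two
  shorter ones.\<close>

lemma qint_add:
  assumes "v \<noteq> 0"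
  shows "qint v (m + n) = v powi n * qint v m + v powi (- m) * qint v n"
  using assms
  by (simp add: qint_def add_divide_distrib[symmetric] algebra_simps
      flip: power_int_add)

lemma qint_double:
  assumes "v \<noteq> 0"
  shows "qint v (2 * n) = (v powi n + v powi (- n)) * qint v n"
  using qint_add[OF assms, of n n] by (simp add: algebra_simps)

lemma qint_pos:
  assumes "1 < v" "0 < n"
  shows "0 < qint v n"
proof -
  have "v powi (- n) < v powi n"
    using assms by (intro power_int_strict_increasing) auto
  moreover have "inverse v < v"
    using assms by (meson inverse_less_1_iff less_trans)
  ultimately show ?thesis
    by (simp add: qint_def)
qed

lemma atLeastAtMost_int_Suc: "{1..int (Suc n)} = insert (int (Suc n)) {1..int n}"
  by auto

lemma qfact_Suc: "qfact v (int (Suc n)) = qfact v (int n) * qint v (int (Suc n))"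
  unfolding qfact_def atLeastAtMost_int_Suc by (subst prod.insert) (auto simp: mult.commute)

lemma qdfact_Suc: "qdfact v (int (Suc n)) = qdfact v (int n) * qint v (2 * int (Suc n))"
  unfolding qdfact_def atLeastAtMost_int_Suc by (subst prod.insert) (auto simp: mult.commute)

lemma qfact_pos: "1 < v \<Longrightarrow> 0 < qfact v n"
  unfolding qfact_def by (intro prod_pos) (auto intro: qint_pos)

lemma qbinom_eq_qfact:
  assumes v: "1 < v" and "b \<le> u"
  shows "qbinom v (int u) (int b) = qfact v (int u) / (qfact v (int b) * qfact v (int (u - b)))"
proof -
  have "(\<Prod>i\<in>{0..<int b}. qint v (int u - i)) * qfact v (int (u - b)) = qfact v (int u)"
    using \<open>b \<le> u\<close>
  proof (induction b)
    case (Suc b)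
    have "{0..<int (Suc b)} = insert (int b) {0..<int b}"
      by auto
    moreover have "qfact v (int (u - b)) = qfact v (int (u - Suc b)) * qint v (int u - int b)"
      using qfact_Suc[of v "u - Suc b"] Suc.prems by (simp add: Suc_diff_Suc)
    ultimately show ?case
      using Suc by (simp add: algebra_simps)
  qed simp
  then show ?thesis
    using qfact_pos[OF v, of "int b"] qfact_pos[OF v, of "int (u - b)"] \<open>b \<le> u\<close>
    by (simp add: qbinom_def field_simps)
qed

section \<open>Convolutions and the q-binomial theorem\<close>

text \<open>The weight \<open>w k\<close> cancels the last factor of the generalized factorial
  \<open>g k\<close>; the term at 0 dies since \<open>w 0 = 0\<close>, and the index shifts down.
  Used for both \<open>qfact\<close> and \<open>qdfact\<close>.\<close>

lemma sum_convolution_left: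
  fixes g w :: "nat \<Rightarrow> 'a :: field"
  assumes "w 0 = 0" "\<And>k. g (Suc k) = g k * w (Suc k)" "\<And>k. w (Suc k) \<noteq> 0"
  shows "(\<Sum>k\<le>Suc n. \<phi> k * w k / (g k * g (Suc n - k))) = (\<Sum>k\<le>n. \<phi> (Suc k) / (g k * g (n - k)))"
  unfolding sum.atMost_Suc_shift using assms by simp

text \<open>Mirror case: the cancellation takes place in \<open>g (Suc n - k)\<close>, and the last
  term dies instead.\<close>

lemma sum_convolution_right:
  fixes g w :: "nat \<Rightarrow> 'a :: field"
  assumes "w 0 = 0" "\<And>k. g (Suc k) = g k * w (Suc k)" "\<And>k. w (Suc k) \<noteq> 0"
  shows "(\<Sum>k\<le>Suc n. \<phi> k * w (Suc n - k) / (g k * g (Suc n - k))) = (\<Sum>k\<le>n. \<phi> k / (g k * g (n - k)))"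
proof -
  have "(\<Sum>k\<le>n. \<phi> k * w (Suc n - k) / (g k * g (Suc n - k))) = (\<Sum>k\<le>n. \<phi> k / (g k * g (n - k)))"
    using assms by (intro sum.cong) (auto simp: Suc_diff_le)
  then show ?thesis
    using assms by simp
qed

text \<open>Induction on \<open>u\<close>, splitting \<open>[u+1]\<close> as
  \<open>v^(u+1-b) [b] + v^(-b) [u+1-b]\<close>. The two halves are \<open>v^(2u) y\<close> and 1
  times the sum for \<open>u\<close>, which yields the new factor of the product.\<close>

lemma q_binomial_theorem:
  assumes v: "1 < v"
  shows "(\<Sum>b\<le>u. y ^ b * v powi (int b * (int u - 1)) / (qfact v (int b) * qfact v (int (u - b))))
    = (\<Prod>i<u. 1 + v ^ (2 * i) * y) / qfact v (int u)"
proof (induction u)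
  case 0
  then show ?case by (simp add: qfact_def)
next
  case (Suc u)
  note w = qint_pos[OF v, THEN less_imp_neq, THEN not_sym]
  let ?D = "\<lambda>u b. qfact v (int b) * qfact v (int (u - b))"
  define e where "e = (\<Sum>b\<le>u. y ^ b * v powi (int b * (int u - 1)) / ?D u b)"
  have "qint v (int (Suc u)) * (\<Sum>b\<le>Suc u. y ^ b * v powi (int b * int u) / ?D (Suc u) b)
    = (\<Sum>b\<le>Suc u. y ^ b * v powi (int b * int u) * v powi (int (Suc u) - int b) * qint v (int b) / ?D (Suc u) b)
    + (\<Sum>b\<le>Suc u. y ^ b * v powi (int b * int u) * v powi (- int b) * qint v (int (Suc u - b)) / ?D (Suc u) b)"
    unfolding sum_distrib_left sum.distrib[symmetric]
  proof (rule sum.cong)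
    fix b assume "b \<in> {..Suc u}"
    then have "qint v (int (Suc u)) = v powi (int (Suc u) - int b) * qint v (int b)
        + v powi (- int b) * qint v (int (Suc u - b))"
      using qint_add[of v "int b" "int (Suc u) - int b"] v by simp
    then show "qint v (int (Suc u)) * (y ^ b * v powi (int b * int u) / ?D (Suc u) b) =
      y ^ b * v powi (int b * int u) * v powi (int (Suc u) - int b) * qint v (int b) / ?D (Suc u) b
      + y ^ b * v powi (int b * int u) * v powi (- int b) * qint v (int (Suc u - b)) / ?D (Suc u) b"
      by (simp only: add_divide_distrib[symmetric] times_divide_eq_right)
        (simp add: algebra_simps)
  qed simp
  also have "(\<Sum>b\<le>Suc u. y ^ b * v powi (int b * int u) * v powi (int (Suc u) - int b) * qint v (int b) / ?D (Suc u) b)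
    = (\<Sum>b\<le>u. y ^ Suc b * v powi (int (Suc b) * int u) * v powi (int (Suc u) - int (Suc b)) / ?D u b)"
    by (rule sum_convolution_left) (use w in \<open>auto simp: qfact_Suc simp del: of_nat_Suc\<close>)
  also have "\<dots> = (v ^ (2 * u) * y) * e"
    unfolding e_def sum_distrib_left
  proof (intro sum.cong refl)
    fix b
    have "v powi (int (Suc b) * int u) * v powi (int (Suc u) - int (Suc b))
      = v powi (int (2 * u)) * v powi (int b * (int u - 1))"
      using v by (simp flip: power_int_add add: algebra_simps del: power_int_of_nat)
    then show "y ^ Suc b * v powi (int (Suc b) * int u) * v powi (int (Suc u) - int (Suc b)) / ?D u b =
      v ^ (2 * u) * y * (y ^ b * v powi (int b * (int u - 1)) / ?D u b)"
      unfolding power_int_of_nat by (simp add: mult.assoc mult.left_commute)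
  qed
  also have "(\<Sum>b\<le>Suc u. y ^ b * v powi (int b * int u) * v powi (- int b) * qint v (int (Suc u - b)) / ?D (Suc u) b)
    = (\<Sum>b\<le>u. y ^ b * v powi (int b * int u) * v powi (- int b) / ?D u b)"
    by (rule sum_convolution_right) (use w in \<open>auto simp: qfact_Suc simp del: of_nat_Suc\<close>)
  also have "\<dots> = e"
    unfolding e_def
  proof (intro sum.cong refl)
    fix b
    have "v powi (int b * int u) * v powi (- int b) = v powi (int b * (int u - 1))"
      using v by (simp flip: power_int_add add: algebra_simps)
    then show "y ^ b * v powi (int b * int u) * v powi (- int b) / ?D u b
      = y ^ b * v powi (int b * (int u - 1)) / ?D u b"
      by (simp add: mult.assoc)
  qed
  finally have "qint v (int (Suc u)) * (\<Sum>b\<le>Suc u. y ^ b * v powi (int b * int u) / ?D (Suc u) b)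
    = (1 + v ^ (2 * u) * y) * e"
    by (simp add: algebra_simps)
  then have "(\<Sum>b\<le>Suc u. y ^ b * v powi (int b * int u) / ?D (Suc u) b)
    = (1 + v ^ (2 * u) * y) * e / qint v (int (Suc u))"
    using w[of "int (Suc u)"] by (simp add: eq_divide_eq mult.commute del: of_nat_Suc sum.atMost_Suc)
  moreover have "e = (\<Prod>i<u. 1 + v ^ (2 * i) * y) / qfact v (int u)"
    using Suc by (simp add: e_def)
  moreover have "int (Suc u) - 1 = int u"
    by simp
  ultimately show ?case
    unfolding \<open>int (Suc u) - 1 = int u\<close>
    by (simp add: qfact_Suc mult.commute del: of_nat_Suc sum.atMost_Suc)
qed

section \<open>Triangular exponents and Gauss's identity\<close>

text \<open>Exponent identities below are doubled first, so that \<open>div\<close> disappears and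
  they become polynomial identities over the integers.\<close>

lemma choose2_double: "2 * choose2 x = x * (x - 1)"
  unfolding choose2_def by simp

lemma choose2_Suc: "choose2 (x + 1) = choose2 x + x"
  using choose2_double[of x] choose2_double[of "x + 1"] by (simp add: algebra_simps)

text \<open>Gauss's evaluation of the Rogers--Szego polynomial of base \<open>v\<^sup>-\<^sup>4\<close> at \<open>v\<^sup>-\<^sup>2\<close>. Splitting
  \<open>[2c]\<close> as \<open>v\<^sup>-\<^sup>2\<^sup>m[2k] + v\<^sup>2\<^sup>k[2m]\<close> makes both halves multiples of the sum for \<open>c - 1\<close>.\<close>

lemma sum_qdfact_convolution:
  assumes v: "1 < v"
  shows "(\<Sum>k\<le>c. v powi (int k * (int k - 1) + int (c - k) * (int (c - k) + 1))
      / (qdfact v (int k) * qdfact v (int (c - k))))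
    = v powi choose2 (int c + 1) / qfact v (int c)"
proof (induction c)
  case 0
  then show ?case by (simp add: qfact_def qdfact_def choose2_def)
next
  case (Suc c)
  note w = qint_pos[OF v, THEN less_imp_neq, THEN not_sym]
  let ?D = "\<lambda>c k. qdfact v (int k) * qdfact v (int (c - k))"
  let ?x = "\<lambda>c k. int k * (int k - 1) + int (c - k) * (int (c - k) + 1)"
  define e where "e = (\<Sum>k\<le>c. v powi ?x c k / ?D c k)"
  let ?S = "\<Sum>k\<le>Suc c. v powi ?x (Suc c) k / ?D (Suc c) k"
  \<comment> \<open>The index m paired with \<open>k\<close>, as an integer so that no truncated
    subtraction enters the exponents.\<close>
  define M where "M k = int (Suc c) - int k" for k
  have "qint v (2 * int (Suc c)) * ?S
    = (\<Sum>k\<le>Suc c. v powi (?x (Suc c) k - 2 * M k) * qint v (2 * int k) / ?D (Suc c) k)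
    + (\<Sum>k\<le>Suc c. v powi (?x (Suc c) k + 2 * int k) * qint v (2 * int (Suc c - k)) / ?D (Suc c) k)"
    unfolding sum_distrib_left sum.distrib[symmetric]
  proof (rule sum.cong)
    fix k assume "k \<in> {..Suc c}"
    then have "qint v (2 * int (Suc c)) = v powi (- 2 * M k) * qint v (2 * int k)
        + v powi (2 * int k) * qint v (2 * int (Suc c - k))"
      using qint_add[of v "2 * M k" "2 * int k"] v by (simp add: M_def)
    moreover have p: "v powi (?x (Suc c) k - 2 * M k) = v powi ?x (Suc c) k * v powi (- 2 * M k)"
      "v powi (?x (Suc c) k + 2 * int k) = v powi ?x (Suc c) k * v powi (2 * int k)"
      using v by (simp_all flip: power_int_add)
    ultimately show "qint v (2 * int (Suc c)) * (v powi ?x (Suc c) k / ?D (Suc c) k) =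
      v powi (?x (Suc c) k - 2 * M k) * qint v (2 * int k) / ?D (Suc c) k
      + v powi (?x (Suc c) k + 2 * int k) * qint v (2 * int (Suc c - k)) / ?D (Suc c) k"
      using p by (simp only: times_divide_eq_right distrib_left add_divide_distrib
          mult.assoc mult.commute mult.left_commute)
  qed simp
  also have "(\<Sum>k\<le>Suc c. v powi (?x (Suc c) k - 2 * M k) * qint v (2 * int k) / ?D (Suc c) k)
    = (\<Sum>k\<le>c. v powi (?x (Suc c) (Suc k) - 2 * M (Suc k)) / ?D c k)"
    by (rule sum_convolution_left) (use w in \<open>auto simp: qdfact_Suc simp del: of_nat_Suc\<close>)
  \<comment> \<open>The shift produces the exponent for \<open>c\<close> with the two indices
    exchanged; as the denominator is symmetric, reversing the sum gives \<open>e\<close>.\<close>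
  also have "\<dots> = (\<Sum>k\<le>c. v powi ?x c (c - k) / ?D c k)"
  proof (intro sum.cong refl)
    fix k assume "k \<in> {..c}"
    then have "?x (Suc c) (Suc k) - 2 * M (Suc k) = ?x c (c - k)"
      by (simp add: M_def algebra_simps)
    then show "v powi (?x (Suc c) (Suc k) - 2 * M (Suc k)) / ?D c k = v powi ?x c (c - k) / ?D c k"
      by simp
  qed
  also have "\<dots> = e"
    unfolding e_def
    by (rule sum.reindex_bij_witness[of _ "\<lambda>k. c - k" "\<lambda>k. c - k"]) (auto simp: mult.commute)
  also have "(\<Sum>k\<le>Suc c. v powi (?x (Suc c) k + 2 * int k) * qint v (2 * int (Suc c - k)) / ?D (Suc c) k)
    = (\<Sum>k\<le>c. v powi (?x (Suc c) k + 2 * int k) / ?D c k)"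
    by (rule sum_convolution_right[where w = "\<lambda>k. qint v (2 * int k)"])
      (use w in \<open>auto simp: qdfact_Suc simp del: of_nat_Suc\<close>)
  also have "\<dots> = v powi (2 * int (Suc c)) * e"
    unfolding e_def sum_distrib_left
  proof (intro sum.cong refl)
    fix k assume "k \<in> {..c}"
    then have *: "?x (Suc c) k + 2 * int k = 2 * int (Suc c) + ?x c k"
      by (simp add: Suc_diff_le algebra_simps)
    have "v powi (?x (Suc c) k + 2 * int k) = v powi (2 * int (Suc c)) * v powi ?x c k"
      unfolding * using v by (intro power_int_add) simp
    then show "v powi (?x (Suc c) k + 2 * int k) / ?D c k
      = v powi (2 * int (Suc c)) * (v powi ?x c k / ?D c k)"
      by (simp only: times_divide_eq_right)
  qed
  finally have double: "qint v (2 * int (Suc c)) * ?S = (1 + v powi (2 * int (Suc c))) * e"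
    by (simp add: algebra_simps)
  \<comment> \<open>\<open>Z\<close> is the common factor to cancel:
    \<open>[2(c+1)] = Z [c+1]\<close> and \<open>1 + v^(2(c+1)) = v^(c+1) Z\<close>.\<close>
  define Z where "Z = v powi int (Suc c) + v powi (- int (Suc c))"
  have "v \<noteq> 0"
    using v by simp
  have "1 + v powi (2 * int (Suc c)) = v powi int (Suc c) * Z"
    unfolding Z_def using v by (simp add: distrib_left flip: power_int_add)
  with double qint_double[OF \<open>v \<noteq> 0\<close>, of "int (Suc c)", folded Z_def]
  have "Z * (qint v (int (Suc c)) * ?S) = Z * (v powi int (Suc c) * e)"
    by (simp only: mult_ac)
  moreover have "Z \<noteq> 0"
    unfolding Z_def using v by (intro less_imp_neq[THEN not_sym] add_pos_pos) auto
  ultimately have "qint v (int (Suc c)) * ?S = v powi int (Suc c) * e"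
    by (rule mult_left_cancel[THEN iffD1, rotated])
  moreover have nz: "qint v (int (Suc c)) \<noteq> 0"
    by (rule w) simp
  ultimately have "?S = v powi int (Suc c) * e / qint v (int (Suc c))"
    using nz by (simp only: nonzero_eq_divide_eq mult.commute[of "qint v (int (Suc c))"])
  also have "\<dots> = v powi choose2 (int c + 1) * v powi int (Suc c) / (qfact v (int c) * qint v (int (Suc c)))"
    using Suc by (simp add: e_def)
  also have "v powi choose2 (int c + 1) * v powi int (Suc c) = v powi choose2 (int (Suc c) + 1)"
    using v choose2_Suc[of "int c + 1"] by (simp add: power_int_add add.commute)
  finally show ?case
    unfolding qfact_Suc .
qed

section \<open>The two factors of the separated sum\<close>

text \<open>Once the exponents are collected, this is the q-binomial theorem at
  \<open>y = -1\<close>, whose product has the factor \<open>1 - 1\<close> at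
  \<open>i = 0\<close>.\<close>

lemma sum_qfact_eq_0:
  assumes v: "1 < v" and "0 < d"
  shows "(\<Sum>r\<le>d. (- 1) ^ r * v powi (2 * int d * int r - choose2 (int r + 1))
      / qfact v (int r) * (v powi choose2 (int (d - r) + 1) / qfact v (int (d - r)))) = 0" (is "?S = 0")
proof -
  have "?S = (\<Sum>r\<le>d. v powi choose2 (int d + 1) * ((- 1) ^ r * v powi (int r * (int d - 1))
      / (qfact v (int r) * qfact v (int (d - r)))))"
  proof (intro sum.cong refl)
    fix r assume r: "r \<in> {..d}"
    have "2 * (2 * int d * int r - choose2 (int r + 1) + choose2 (int (d - r) + 1))
      = 2 * (choose2 (int d + 1) + int r * (int d - 1))"
      unfolding distrib_left right_diff_distrib choose2_double using r
      by (simp add: algebra_simps)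
    then have "2 * int d * int r - choose2 (int r + 1) + choose2 (int (d - r) + 1)
      = choose2 (int d + 1) + int r * (int d - 1)"
      by (rule mult_left_cancel[THEN iffD1, rotated]) simp
    then have "v powi (2 * int d * int r - choose2 (int r + 1)) * v powi choose2 (int (d - r) + 1)
      = v powi choose2 (int d + 1) * v powi (int r * (int d - 1))"
      using v by (simp flip: power_int_add)
    then show "(- 1) ^ r * v powi (2 * int d * int r - choose2 (int r + 1))
      / qfact v (int r) * (v powi choose2 (int (d - r) + 1) / qfact v (int (d - r)))
      = v powi choose2 (int d + 1) * ((- 1) ^ r * v powi (int r * (int d - 1))
      / (qfact v (int r) * qfact v (int (d - r))))"
      by (simp add: mult.assoc mult.left_commute)
  qed
  also have "\<dots> = v powi choose2 (int d + 1) * ((\<Prod>i<d. 1 + v ^ (2 * i) * - 1) / qfact v (int d))"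
    unfolding q_binomial_theorem[OF v, symmetric] sum_distrib_left ..
  also have "(\<Prod>i<d. 1 + v ^ (2 * i) * - 1) = 0"
    using \<open>0 < d\<close> by (simp add: prod_zero_iff[OF finite_lessThan] bexI[of _ 0])
  finally show ?thesis by simp
qed

text \<open>The q-binomial theorem at \<open>y = -v^(2d)\<close>.\<close>

lemma sum_qbinom:
  assumes v: "1 < v"
  shows "(\<Sum>b\<le>u. (- 1) ^ b * v powi (int b * (int u + 2 * int d - 1)) * qbinom v (int u) (int b))
    = (\<Prod>i<u. 1 - v ^ (2 * i + 2 * d))" (is "?S = _")
proof -
  have "?S = (\<Sum>b\<le>u. qfact v (int u) * ((- (v ^ (2 * d))) ^ b * v powi (int b * (int u - 1))
      / (qfact v (int b) * qfact v (int (u - b)))))"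
  proof (intro sum.cong refl)
    fix b assume b: "b \<in> {..u}"
    have "v powi (int b * (int u + 2 * int d - 1)) = v powi int (2 * d * b) * v powi (int b * (int u - 1))"
      using v by (simp flip: power_int_add add: algebra_simps del: power_int_of_nat)
    then show "(- 1) ^ b * v powi (int b * (int u + 2 * int d - 1)) * qbinom v (int u) (int b)
      = qfact v (int u) * ((- (v ^ (2 * d))) ^ b * v powi (int b * (int u - 1))
      / (qfact v (int b) * qfact v (int (u - b))))"
      using b unfolding power_int_of_nat
      by (simp add: qbinom_eq_qfact[OF v] power_mult power_minus[of "_ ^ _"])
  qed
  also have "\<dots> = qfact v (int u) * ((\<Prod>i<u. 1 + v ^ (2 * i) * - (v ^ (2 * d))) / qfact v (int u))"
    unfolding q_binomial_theorem[OF v, symmetric] sum_distrib_left ..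
  finally show ?thesis
    using qfact_pos[OF v, of "int u"] by (simp add: power_add)
qed

section \<open>Separation of the triple sum\<close>

text \<open>The value given for \<open>n\<close> solves \<open>b = 1 + a - n - 2m - r\<close> with
  \<open>r = d - k - m\<close>. The exponent then splits into a constant, a part in
  \<open>b\<close>, a part in \<open>r\<close>, and a part in \<open>(k, m)\<close>.\<close>

lemma zexp_eq:
  "zexp a d u (a + 1 - d + k - m - b) k m
    = (1 - (a + 1 - 2 * d) * (2 * d - 1)) + b * (u + 2 * d - 1)
      + (2 * d * (d - k - m) - choose2 (d - k - m + 1)) + (k * (k - 1) + m * (m + 1))"
  (is "?l = ?r")
proof -
  have "2 * ?l = 2 * ?r"
    unfolding zexp_def pexp_def distrib_left right_diff_distrib choose2_double
    by (simp add: algebra_simps power2_eq_square choose2_double)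
  then show ?thesis
    by (rule mult_left_cancel[THEN iffD1, rotated]) simp
qed

text \<open>The support of \<open>g\<close> lies in \<open>r >= 0\<close> and
  \<open>0 <= b <= u\<close>, which the new indices parametrize. Conversely,
  \<open>u <= N - 2d\<close> gives \<open>n >= 2k\<close>, and \<open>k + m <= d\<close> gives
  \<open>N - n >= 2m\<close>, so no new triple leaves the old ranges.\<close>

lemma sum_reindex_triples:
  fixes g :: "int \<Rightarrow> int \<Rightarrow> int \<Rightarrow> real"
  assumes "2 * d \<le> N" "u \<le> N - 2 * d"
    and zero: "\<And>n k m. \<not> (0 \<le> int d - k - m \<and> int d - k - m \<le> n - 2 * k
      \<and> 0 \<le> int N - n - 2 * m - (int d - k - m) \<and> int N - n - 2 * m - (int d - k - m) \<le> int u)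
      \<Longrightarrow> g n k m = 0"
  shows "(\<Sum>n\<in>{0..int N}. \<Sum>k\<in>{0..n div 2}. \<Sum>m\<in>{0..(int N - n) div 2}. g n k m)
    = (\<Sum>(k, m)\<in>{(k, m). k + m \<le> d}. \<Sum>b\<le>u.
        g (int N - int d + int k - int m - int b) (int k) (int m))"
proof -
  let ?S = "SIGMA n:{0..int N}. {0..n div 2} \<times> {0..(int N - n) div 2}"
  let ?K = "{(k, m). k + m \<le> d} \<times> {..u}"
  define h where "h = (\<lambda>((k, m), b). (int N - int d + int k - int m - int b, int k, int m))"
  define G where "G = (\<lambda>(n, k, m). g n k m)"
  have "(\<Sum>n\<in>{0..int N}. \<Sum>k\<in>{0..n div 2}. \<Sum>m\<in>{0..(int N - n) div 2}. g n k m) = sum G ?S"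
    by (simp add: sum.Sigma sum.cartesian_product G_def)
  also have "\<dots> = sum G (h ` ?K)"
  proof (rule sum.mono_neutral_right)
    show "h ` ?K \<subseteq> ?S"
      using assms(1,2) by (auto simp: h_def)
    show "\<forall>x\<in>?S - h ` ?K. G x = 0"
    proof (safe, rule ccontr)
      fix n k m
      assume "k \<in> {0..n div 2}" "m \<in> {0..(int N - n) div 2}"
        and notin: "(n, k, m) \<notin> h ` ?K" and "G (n, k, m) \<noteq> 0"
      with zero[of k m n]
      have *: "0 \<le> int d - k - m" "0 \<le> int N - n - 2 * m - (int d - k - m)"
        "int N - n - 2 * m - (int d - k - m) \<le> int u" "0 \<le> k" "0 \<le> m"
        unfolding G_def by auto
      then have "((nat k, nat m), nat (int N - n - m - int d + k)) \<in> ?K"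
        by auto
      moreover have "(n, k, m) = h ((nat k, nat m), nat (int N - n - m - int d + k))"
        using * by (auto simp: h_def)
      ultimately show False
        using notin by blast
    qed
  qed simp
  also have "\<dots> = sum (G \<circ> h) ?K"
    by (rule sum.reindex) (auto simp: inj_on_def h_def)
  finally show ?thesis
    by (simp add: sum.cartesian_product case_prod_unfold G_def h_def comp_def)
qed

text \<open>Exchanging \<open>k\<close> and \<open>m\<close> turns the exponent \<open>z + 2k - 2m\<close> into \<open>z\<close> and preserves the parity
  of \<open>n\<close>, so both \<open>T\<close> (\<open>s = True\<close>) and \<open>T\<^sub>1\<close> (\<open>s = False\<close>) equal the plain alternating sum.\<close>

lemma alternating_sum_eq_0:
  fixes s :: bool
  assumes v: "1 < v" and "2 * d \<le> N" "u \<le> N - 2 * d" and "\<not> (d = 0 \<and> u = 0)"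
  shows "(\<Sum>n\<in>{0..int N}. \<Sum>k\<in>{0..n div 2}. \<Sum>m\<in>{0..(int N - n) div 2}.
    (if even n then 1 else - 1) * summand v (int N - 1) (int d) (int u) n k m
      (if even n = s then zexp (int N - 1) (int d) (int u) n k m
       else zexp (int N - 1) (int d) (int u) n k m + 2 * k - 2 * m)) = 0"
    (is "?L = 0")
proof -
  define K where "K = {(k, m). k + m \<le> d}"
  \<comment> \<open>\<open>B\<close>, \<open>R\<close> and \<open>E\<close> collect the factors in
    \<open>b\<close>, \<open>r\<close> and \<open>(k, m)\<close>; \<open>C\<close> is the
    constant.\<close>
  define B where "B b = (- 1) ^ b * v powi (int b * (int u + 2 * int d - 1)) * qbinom v (int u) (int b)" for b
  define R where "R r = (- 1) ^ r * v powi (2 * int d * int r - choose2 (int r + 1)) / qfact v (int r)" for r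
  define E where "E k m = v powi (int k * (int k - 1) + int m * (int m + 1))
    / (qdfact v (int k) * qdfact v (int m))" for k m
  define C where "C = (- 1) ^ N * v powi (1 - (int N - 2 * int d) * (2 * int d - 1))"
  \<comment> \<open>Exchanges \<open>k\<close> and \<open>m\<close> exactly where the parity of
    \<open>n\<close> selects \<open>z + 2k - 2m\<close>. For fixed \<open>b\<close> that parity
    depends only on \<open>k + m\<close>, so \<open>sw b\<close> is an involution of
    \<open>K\<close> that leaves \<open>R\<close> unchanged.\<close>
  define sw where "sw b = (\<lambda>(k, m). if even (N + (d - k - m) + b) = s then (k, m) else (m, k))" for b
  have inner: "(\<Sum>(k, m)\<in>K. C * R (d - k - m) * B b * (case sw b (k, m) of (k, m) \<Rightarrow> E k m))
      = C * B b * (\<Sum>(k, m)\<in>K. R (d - k - m) * E k m)" for b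
  proof -
    have "(\<Sum>(k, m)\<in>K. C * R (d - k - m) * B b * (case sw b (k, m) of (k, m) \<Rightarrow> E k m))
      = (\<Sum>(k, m)\<in>K. C * R (d - k - m) * B b * E k m)"
      by (rule sum.reindex_bij_witness[of _ "sw b" "sw b"])
        (auto simp: K_def sw_def add.commute split: if_splits)
    also have "\<dots> = C * B b * (\<Sum>(k, m)\<in>K. R (d - k - m) * E k m)"
      unfolding sum_distrib_left case_prod_unfold by (intro sum.cong refl) (simp only: mult_ac)
    finally show ?thesis .
  qed
  have "?L = (\<Sum>(k, m)\<in>K. \<Sum>b\<le>u.
    (let n = int N - int d + int k - int m - int b in
    (if even n then 1 else - 1) * summand v (int N - 1) (int d) (int u) n (int k) (int m)
      (if even n = s then zexp (int N - 1) (int d) (int u) n (int k) (int m)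
       else zexp (int N - 1) (int d) (int u) n (int k) (int m) + 2 * int k - 2 * int m)))"
    unfolding Let_def K_def
    by (rule sum_reindex_triples) (use assms in \<open>auto simp: summand_def Let_def qbinom_def\<close>)
  also have "\<dots> = (\<Sum>(k, m)\<in>K. \<Sum>b\<le>u. C * R (d - k - m) * B b * (case sw b (k, m) of (k, m) \<Rightarrow> E k m))"
  proof (intro sum.cong refl, clarify, intro sum.cong refl)
    fix k m b
    assume "(k, m) \<in> K" "b \<in> {..u}"
    then have km: "k + m \<le> d" and "b \<le> u"
      by (auto simp: K_def)
    define r where "r = d - k - m"
    have r: "int d - int k - int m = int r"
      using km by (simp add: r_def of_nat_diff)
    define n where "n = int N - int d + int k - int m - int b"
    have n: "n = int N - int r - 2 * int m - int b"
      using r by (simp add: n_def)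
    have even_n: "even n \<longleftrightarrow> even (N + r + b)"
      unfolding n by simp
    define y where "y = (if even n = s then 0 else 2 * int k - 2 * int m)"
    have y: "(if even n = s then z else z + 2 * int k - 2 * int m) = z + y" for z
      by (simp add: y_def)
    let ?c = "1 - (int N - 2 * int d) * (2 * int d - 1)"
    let ?x = "2 * int d * int r - choose2 (int r + 1)"
    let ?b = "int b * (int u + 2 * int d - 1)"
    let ?e = "int k * (int k - 1) + int m * (int m + 1)"
    have z: "zexp (int N - 1) (int d) (int u) n (int k) (int m) = ?c + ?b + ?x + ?e"
      using zexp_eq[of "int N - 1" "int d" "int u" "int k" "int m" "int b"] r
      by (simp add: n_def)
    have sgn: "(if even n then 1 else - 1 :: real) = (- 1) ^ N * (- 1) ^ r * (- 1) ^ b"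
      unfolding even_n by (simp flip: power_add)
    have sw: "(case sw b (k, m) of (k, m) \<Rightarrow> E k m)
      = v powi (?e + y) / (qdfact v (int k) * qdfact v (int m))"
    proof -
      \<comment> \<open>The extra \<open>2k - 2m\<close> in the exponent amounts to exchanging
        \<open>k\<close> and \<open>m\<close>.\<close>
      have "?e + (2 * int k - 2 * int m) = int m * (int m - 1) + int k * (int k + 1)"
        by (simp add: algebra_simps)
      then show ?thesis
        using even_n unfolding sw_def y_def r_def[symmetric] case_prod_conv
        by (cases "even n = s") (simp_all add: E_def mult.commute)
    qed
    have "summand v (int N - 1) (int d) (int u) n (int k) (int m)
        (zexp (int N - 1) (int d) (int u) n (int k) (int m) + y)
      = v powi (?c + ?b + ?x + (?e + y)) / (qfact v (int r) * qdfact v (int k) * qdfact v (int m))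
        * qbinom v (int u) (int b)"
    proof -
      \<comment> \<open>Here \<open>n - 2k - r = N - 2d - b\<close>, so the condition in
        \<open>summand\<close> follows from \<open>b <= u <= N - 2d\<close>.\<close>
      have "int r \<le> n - 2 * int k"
        using n km r \<open>b \<le> u\<close> assms(2,3) by linarith
      then show ?thesis
        unfolding summand_def r Let_def z by (simp add: n add.assoc)
    qed
    also have "v powi (?c + ?b + ?x + (?e + y)) = v powi ?c * v powi ?b * v powi ?x * v powi (?e + y)"
      using v by (simp only: power_int_add[OF disjI1[OF less_imp_neq[OF less_trans[OF zero_less_one v], THEN not_sym]]])
    finally show "(let n = int N - int d + int k - int m - int b in
      (if even n then 1 else - 1) * summand v (int N - 1) (int d) (int u) n (int k) (int m)
      (if even n = s then zexp (int N - 1) (int d) (int u) n (int k) (int m)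
       else zexp (int N - 1) (int d) (int u) n (int k) (int m) + 2 * int k - 2 * int m))
      = C * R (d - k - m) * B b * (case sw b (k, m) of (k, m) \<Rightarrow> E k m)"
      unfolding Let_def n_def[symmetric] y sgn sw C_def R_def B_def r_def[symmetric]
      by (simp add: mult_ac)
  qed
  \<comment> \<open>With \<open>b\<close> outermost, the exchange \<open>sw b\<close> can be undone
    in each inner sum.\<close>
  also have "\<dots> = (\<Sum>b\<le>u. \<Sum>(k, m)\<in>K. C * R (d - k - m) * B b * (case sw b (k, m) of (k, m) \<Rightarrow> E k m))"
    unfolding case_prod_unfold by (rule sum.swap)
  also have "\<dots> = (\<Sum>b\<le>u. C * B b * (\<Sum>(k, m)\<in>K. R (d - k - m) * E k m))"
    by (simp only: inner)
  also have "\<dots> = C * (\<Sum>b\<le>u. B b) * (\<Sum>(k, m)\<in>K. R (d - k - m) * E k m)"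
    by (simp only: sum_distrib_left[symmetric] sum_distrib_right[symmetric])
  \<comment> \<open>Along the diagonal \<open>k + m = c\<close> the factor \<open>R\<close> is
    constant, leaving Gauss's sum.\<close>
  also have "(\<Sum>(k, m)\<in>K. R (d - k - m) * E k m) = (\<Sum>c\<le>d. \<Sum>k\<le>c. R (d - c) * E k (c - k))"
    unfolding K_def sum.triangle_reindex_eq by (intro sum.cong refl) simp
  also have "\<dots> = (\<Sum>c\<le>d. R (d - c) * (v powi choose2 (int c + 1) / qfact v (int c)))"
    unfolding E_def sum_distrib_left[symmetric] sum_qdfact_convolution[OF v] ..
  also have "\<dots> = (\<Sum>r\<le>d. R r * (v powi choose2 (int (d - r) + 1) / qfact v (int (d - r))))"
    by (rule sum.reindex_bij_witness[of _ "\<lambda>r. d - r" "\<lambda>r. d - r"]) auto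
  also have "C * (\<Sum>b\<le>u. B b) * \<dots> = 0"
  proof (cases "d = 0")
    case True
    then have "(\<Sum>b\<le>u. B b) = 0"
      unfolding B_def sum_qbinom[OF v] using assms(4) by (simp add: bexI[of _ 0])
    then show ?thesis by simp
  next
    case False
    then show ?thesis
      using sum_qfact_eq_0[OF v, of d] by (simp add: R_def)
  qed
  finally show ?thesis .
qed

section \<open>Vanishing of \<open>T\<close> and \<open>T1\<close>\<close>

lemma sum_even_minus_sum_odd:
  fixes f g :: "int \<Rightarrow> 'a :: comm_ring_1"
  assumes "finite A"
  shows "(\<Sum>n\<in>{n\<in>A. even n}. f n) - (\<Sum>n\<in>{n\<in>A. odd n}. g n)
    = (\<Sum>n\<in>A. (if even n then 1 else - 1) * (if even n then f n else g n))"
proof -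
  have "(\<Sum>n\<in>A. (if even n then 1 else - 1) * (if even n then f n else g n))
    = (\<Sum>n\<in>A. if even n then f n else - g n)"
    by (intro sum.cong) auto
  then show ?thesis
    using assms by (simp add: sum.If_cases sum_negf Int_def)
qed

theorem proposition8p1:
  fixes q :: nat and v :: real and a d u :: int
  assumes "primepow q" and "v = sqrt (real q)"
    and "a \<ge> 0"
    and "0 \<le> d" and "2 * d \<le> a + 1"
    and "0 \<le> u" and "u \<le> a + 1 - 2 * d"
    and "\<not> (d = 0 \<and> u = 0)"
  shows "T v a d u = 0 \<and> T1 v a d u = 0"
proof -
  \<comment> \<open>A prime power exceeds 1, hence so does its root, and no \<open>[n]\<close> with
    \<open>n > 0\<close> vanishes.\<close>
  have v: "1 < v"
    using primepow_gt_Suc_0[OF assms(1)] assms(2) by simp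
  obtain N D U where "a + 1 = int N" and d: "d = int D" and u: "u = int U"
    using zero_le_imp_eq_int[of "a + 1"] zero_le_imp_eq_int[of d] zero_le_imp_eq_int[of u] assms by auto
  then have a: "a = int N - 1"
    by simp
  have ND: "2 * D \<le> N" "U \<le> N - 2 * D" "\<not> (D = 0 \<and> U = 0)"
    using assms unfolding a d u by auto
  \<comment> \<open>For odd \<open>n\<close> the two quotients agree, so even and odd terms share
    one range of \<open>k\<close>.\<close>
  have odd_div: "(\<Sum>n\<in>{n\<in>A. odd n}. \<Sum>k\<in>{0..(n - 1) div 2}. f n k)
    = (\<Sum>n\<in>{n\<in>A. odd n}. \<Sum>k\<in>{0..n div 2}. f n k)" for A :: "int set" and f :: "int \<Rightarrow> int \<Rightarrow> real"
    by (intro sum.cong) (auto elim!: oddE)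
  note zero = alternating_sum_eq_0[OF v ND]
  have "T v a d u = 0"
    unfolding T_def odd_div sum_even_minus_sum_odd[OF finite_atLeastAtMost_int] zero[of True, symmetric]
    unfolding a d u diff_add_cancel
    by (intro sum.cong refl) (simp add: sum_negf)
  moreover have "T1 v a d u = 0"
    unfolding T1_def odd_div sum_even_minus_sum_odd[OF finite_atLeastAtMost_int] zero[of False, symmetric]
    unfolding a d u diff_add_cancel
    by (intro sum.cong refl) (simp add: sum_negf)
  ultimately show ?thesis ..
qed

end
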